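(* For any probability distribution on regular bipartite graphs with $2n$ nodes, there exists a deterministic algorithm for finding a perfect matching that runs in average time $O(n\log n)$ on graphs drawn from this distribution.
   Context: A bipartite graph $G=(P,Q,E)$ has vertex set $P\cup Q$ and edge set $E\subseteq P\times Q$; it is regular if all its vertices have the same degree $d\geq 1$, in which case $|P|=|Q|=n$. Graphs are given in adjacency array representation: for each vertex, its neighbors are stored in an array whose entries can be accessed in constant time, in arbitrary order. The deterministic algorithm may depend on the distribution (and on $n$). Average time means expected running time over the random input graph drawn from the distribution; the constant implied by $O(\cdot)$ is absolute. *)

theory Defs
  imports "HOL-Probability.Probability" "HOL-Library.Landau_Symbols"
begin

section \<open>Regular bipartite graphs and perfect matchings\<close>

text \<open>
  A bipartite graph with sides \<open>P\<close> and \<open>Q\<close> of size \<open>n\<close> is given by its edge set; both sides are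
  numbered \<open>0, \<dots>, n - 1\<close>, and \<open>(p, q) \<in> E\<close> joins vertex \<open>p\<close> of \<open>P\<close> to vertex \<open>q\<close> of \<open>Q\<close>.
\<close>

type_synonym bigraph = "(nat \<times> nat) set"

datatype side = PSide | QSide

definition neighbours :: "bigraph \<Rightarrow> side \<Rightarrow> nat \<Rightarrow> nat set" where
  "neighbours E s u = (case s of PSide \<Rightarrow> {q. (u, q) \<in> E} | QSide \<Rightarrow> {p. (p, u) \<in> E})"

definition regular_bipartite :: "nat \<Rightarrow> bigraph \<Rightarrow> bool" where
  "regular_bipartite n E \<longleftrightarrow>
     E \<subseteq> {..<n} \<times> {..<n} \<and> (\<exists>d\<ge>1. \<forall>s. \<forall>u<n. card (neighbours E s u) = d)"

definition perfect_matching :: "nat \<Rightarrow> bigraph \<Rightarrow> bigraph \<Rightarrow> bool" where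
  "perfect_matching n E M \<longleftrightarrow>
     M \<subseteq> E \<and> (\<forall>p<n. \<exists>!q. (p, q) \<in> M) \<and> (\<forall>q<n. \<exists>!p. (p, q) \<in> M)"

text \<open>
  For each side, the list of the adjacency arrays of its vertices. The order of the neighbours within
  an array is not constrained.
\<close>

type_synonym adj_arrays = "side \<Rightarrow> nat list list"

definition represents :: "nat \<Rightarrow> bigraph \<Rightarrow> adj_arrays \<Rightarrow> bool" where
  "represents n E A \<longleftrightarrow>
     (\<forall>s. length (A s) = n \<and>
          (\<forall>u<n. distinct (A s ! u) \<and> set (A s ! u) = neighbours E s u))"


section \<open>Deterministic algorithms: a word RAM\<close>

text \<open>
  Programs are while programs over random access memory whose cells hold \<open>w\<close>-bit words. The
  memory is organised in arrays with fixed names (a scalar variable is cell \<open>0\<close> of an array), all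
  cells being \<open>0\<close> at the start. The input graph is accessible only through
  \<open>Degree\<close> and \<open>Neighbour\<close>, which read the length and a single entry of an adjacency array.
\<close>

datatype binop = Add | Sub | Mul | Div | Mod | Less | Equal

datatype expr =
    Const nat
  | Cell nat expr
  | Op binop expr expr
  | Degree side expr
  | Neighbour side expr expr

datatype prog =
    Skip
  | Store nat expr expr
  | Seq prog prog
  | If expr prog prog
  | While expr prog

type_synonym memory = "nat \<Rightarrow> nat \<Rightarrow> nat"

fun binop_val :: "binop \<Rightarrow> nat \<Rightarrow> nat \<Rightarrow> nat" where
  "binop_val Add x y = x + y"
| "binop_val Sub x y = x - y"
| "binop_val Mul x y = x * y"
| "binop_val Div x y = x div y"
| "binop_val Mod x y = x mod y"
| "binop_val Less x y = of_bool (x < y)"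
| "binop_val Equal x y = of_bool (x = y)"

text \<open>Every value is truncated to \<open>w\<close> bits; reads outside the input arrays return \<open>0\<close>.\<close>

fun expr_val :: "nat \<Rightarrow> adj_arrays \<Rightarrow> memory \<Rightarrow> expr \<Rightarrow> nat" where
  "expr_val w A m (Const c) = c mod 2 ^ w"
| "expr_val w A m (Cell a e) = m a (expr_val w A m e)"
| "expr_val w A m (Op f e1 e2) = binop_val f (expr_val w A m e1) (expr_val w A m e2) mod 2 ^ w"
| "expr_val w A m (Degree s e) =
     (let u = expr_val w A m e
      in if u < length (A s) then length (A s ! u) mod 2 ^ w else 0)"
| "expr_val w A m (Neighbour s e1 e2) =
     (let u = expr_val w A m e1; i = expr_val w A m e2
      in if u < length (A s) \<and> i < length (A s ! u) then (A s ! u ! i) mod 2 ^ w else 0)"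

text \<open>Unit cost for each constant, memory access, operation, and input access.\<close>

fun expr_cost :: "expr \<Rightarrow> nat" where
  "expr_cost (Const c) = 1"
| "expr_cost (Cell a e) = 1 + expr_cost e"
| "expr_cost (Op f e1 e2) = 1 + expr_cost e1 + expr_cost e2"
| "expr_cost (Degree s e) = 1 + expr_cost e"
| "expr_cost (Neighbour s e1 e2) = 1 + expr_cost e1 + expr_cost e2"

text \<open>
  \<open>exec w A c m t m'\<close>: on input \<open>A\<close>, program \<open>c\<close> started in memory \<open>m\<close> halts after \<open>t\<close> time units in
  memory \<open>m'\<close>. A test succeeds iff its value is nonzero.
\<close>

inductive exec :: "nat \<Rightarrow> adj_arrays \<Rightarrow> prog \<Rightarrow> memory \<Rightarrow> nat \<Rightarrow> memory \<Rightarrow> bool"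
  for w :: nat and A :: adj_arrays where
  Skip: "exec w A Skip m 1 m"
| Store: "exec w A (Store a e1 e2) m (1 + expr_cost e1 + expr_cost e2)
            (m(a := (m a)(expr_val w A m e1 := expr_val w A m e2)))"
| Seq: "exec w A c1 m t1 m1 \<Longrightarrow> exec w A c2 m1 t2 m2 \<Longrightarrow> exec w A (Seq c1 c2) m (t1 + t2) m2"
| IfTrue: "expr_val w A m e \<noteq> 0 \<Longrightarrow> exec w A c1 m t m' \<Longrightarrow>
            exec w A (If e c1 c2) m (1 + expr_cost e + t) m'"
| IfFalse: "expr_val w A m e = 0 \<Longrightarrow> exec w A c2 m t m' \<Longrightarrow>
            exec w A (If e c1 c2) m (1 + expr_cost e + t) m'"
| WhileFalse: "expr_val w A m e = 0 \<Longrightarrow> exec w A (While e c) m (1 + expr_cost e) m"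
| WhileTrue: "expr_val w A m e \<noteq> 0 \<Longrightarrow> exec w A c m t1 m1 \<Longrightarrow> exec w A (While e c) m1 t2 m2 \<Longrightarrow>
            exec w A (While e c) m (1 + expr_cost e + t1 + t2) m2"

lemma exec_deterministic:
  assumes "exec w A c m t m'" and "exec w A c m t2 m2"
  shows "t2 = t \<and> m2 = m'"
  using assms
proof (induction arbitrary: t2 m2 rule: exec.induct)
  case (Skip m)
  from Skip.prems show ?case by cases auto
next
  case (Store a e1 e2 m)
  from Store.prems show ?case by cases auto
next
  case (Seq c1 m t1 m1 c2 t m')
  from Seq.prems obtain s1 n1 s2
    where *: "t2 = s1 + s2" "exec w A c1 m s1 n1" "exec w A c2 n1 s2 m2"
    by cases auto
  from Seq.IH(1)[OF *(2)] have eq: "s1 = t1" "n1 = m1" by simp_all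
  from *(3) have "exec w A c2 m1 s2 m2" unfolding eq .
  from Seq.IH(2)[OF this] show ?case using *(1) eq by simp
next
  case (IfTrue m e c1 t m' c2)
  from IfTrue.prems IfTrue.hyps(1) obtain s
    where *: "t2 = 1 + expr_cost e + s" "exec w A c1 m s m2"
    by cases auto
  from IfTrue.IH[OF *(2)] show ?case using *(1) by simp
next
  case (IfFalse m e c2 t m' c1)
  from IfFalse.prems IfFalse.hyps(1) obtain s
    where *: "t2 = 1 + expr_cost e + s" "exec w A c2 m s m2"
    by cases auto
  from IfFalse.IH[OF *(2)] show ?case using *(1) by simp
next
  case (WhileFalse m e c)
  from WhileFalse.prems show ?case by cases (use WhileFalse.hyps in auto)
next
  case (WhileTrue m e c t1 m1 t m')
  from WhileTrue.prems WhileTrue.hyps(1) obtain s1 n1 s2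
    where *: "t2 = 1 + expr_cost e + s1 + s2" "exec w A c m s1 n1" "exec w A (While e c) n1 s2 m2"
    by cases auto
  from WhileTrue.IH(1)[OF *(2)] have eq: "s1 = t1" "n1 = m1" by simp_all
  from *(3) have "exec w A (While e c) m1 s2 m2" unfolding eq .
  from WhileTrue.IH(2)[OF this] show ?case using *(1) eq by simp
qed

definition initial_memory :: memory where
  "initial_memory = (\<lambda>a i. 0)"

definition running_time :: "nat \<Rightarrow> prog \<Rightarrow> adj_arrays \<Rightarrow> nat" where
  "running_time w c A = (THE t. \<exists>m. exec w A c initial_memory t m)"

text \<open>The output convention: cell \<open>p\<close> of array \<open>0\<close> holds the partner of vertex \<open>p\<close> of \<open>P\<close>.\<close>

definition output_matching :: "nat \<Rightarrow> memory \<Rightarrow> bigraph" where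
  "output_matching n m = {(p, m 0 p) | p. p < n}"

definition finds_perfect_matching :: "nat \<Rightarrow> nat \<Rightarrow> prog \<Rightarrow> bool" where
  "finds_perfect_matching w n c \<longleftrightarrow>
     (\<forall>E A. regular_bipartite n E \<and> represents n E A \<longrightarrow>
        (\<exists>t m. exec w A c initial_memory t m \<and> perfect_matching n E (output_matching n m)))"

end

theory Submission
  imports Defs "HOL-Real_Asymp.Real_Asymp"
begin

text \<open>
  From a random free vertex of \<open>P\<close>, walk along random edges to \<open>Q\<close>, returning to \<open>P\<close> along matching
  edges, until a free vertex of \<open>Q\<close> is hit. By regularity, the mean lengths of the walks from the \<open>k\<close>
  free vertices add up to at most \<open>n\<close>, so that one augmentation costs \<open>O(n / k)\<close> on average, which
  sums to \<open>O(n log n)\<close>. Since a program may depend on the distribution, all random choices are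
  hardcoded, separately for each degree, and fixed one by one without raising the weighted mean
  time over the finitely many inputs. As every input gets positive weight, an input on which a
  sufficiently long sequence of choices did not finish would exceed this mean; hence no fallback is
  needed.
\<close>

section \<open>Regular adjacency arrays, partial matchings and mean walk lengths\<close>

text \<open>The programs read only the arrays of \<open>P\<close>, so the degrees in
  \<open>Q\<close> appear as numbers of arrays containing \<open>q\<close>.\<close>

definition adj_regular :: "nat \<Rightarrow> nat \<Rightarrow> nat list list \<Rightarrow> bool" where
  "adj_regular n d a \<longleftrightarrow> length a = n \<and>
     (\<forall>u<n. length (a ! u) = d \<and> distinct (a ! u) \<and> set (a ! u) \<subseteq> {..<n}) \<and>
     (\<forall>q<n. card {u. u < n \<and> q \<in> set (a ! u)} = d)"

text \<open>The free set \<open>F\<close> is a parameter: start vertices are hardcoded, so it is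
  common to all inputs, whereas \<open>f\<close> and \<open>g\<close> vary with the input.\<close>

definition partial_matching ::
  "nat \<Rightarrow> nat list list \<Rightarrow> nat set \<Rightarrow> (nat \<Rightarrow> nat) \<Rightarrow> (nat \<Rightarrow> nat) \<Rightarrow> bool" where
  "partial_matching n a F f g \<longleftrightarrow>
     (\<forall>p<n. p \<notin> F \<longrightarrow> f p < n \<and> f p \<in> set (a ! p) \<and> g (f p) = Suc p) \<and>
     (\<forall>q<n. g q \<noteq> 0 \<longrightarrow> g q \<le> n \<and> g q - 1 \<notin> F \<and> f (g q - 1) = q)"

text \<open>
  Here and in array \<open>1\<close> of the programs below, \<open>g q\<close> is the partner of \<open>q\<close> plus one, or \<open>0\<close> if \<open>q\<close> is
  free. Likewise the position of a walk is a vertex of \<open>P\<close> plus one, or \<open>0\<close> once it has finished.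
\<close>

primrec walk_len :: "nat list list \<Rightarrow> (nat \<Rightarrow> nat) \<Rightarrow> nat list \<Rightarrow> nat \<Rightarrow> nat" where
  "walk_len a g [] c = 0"
| "walk_len a g (r # rs) c = (if c = 0 then 0 else Suc (walk_len a g rs (g (a ! (c - 1) ! r))))"

text \<open>The expectation of \<open>walk_len\<close> over \<open>L\<close> independent uniform
  choices below \<open>d\<close>; the cutoff \<open>L\<close> keeps it a finite recursion.\<close>

primrec mean_len :: "nat \<Rightarrow> nat list list \<Rightarrow> (nat \<Rightarrow> nat) \<Rightarrow> nat \<Rightarrow> nat \<Rightarrow> real" where
  "mean_len d a g 0 c = 0"
| "mean_len d a g (Suc L) c =
     (if c = 0 then 0 else 1 + (\<Sum>r<d. mean_len d a g L (g (a ! (c - 1) ! r))) / real d)"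

lemma mean_len_nonneg: "0 \<le> mean_len d a g L c"
  by (induction L arbitrary: c) (auto intro!: add_nonneg_nonneg divide_nonneg_nonneg sum_nonneg)

lemma mean_len_0 [simp]: "mean_len d a g L 0 = 0"
  by (cases L) auto

lemma mean_len_mono: "mean_len d a g L c \<le> mean_len d a g (Suc L) c"
proof (induction L arbitrary: c)
  case 0
  show ?case by simp
next
  case (Suc L)
  show ?case
    unfolding mean_len.simps(2)[of d a g L c] mean_len.simps(2)[of d a g "Suc L" c]
    by (auto intro!: divide_right_mono sum_mono Suc.IH simp del: mean_len.simps)
qed

text \<open>Double counting of edges: each \<open>q\<close> occurs in exactly \<open>d\<close>
  arrays, once in each.\<close>

lemma sum_adjacent:
  fixes \<phi> :: "nat \<Rightarrow> real"
  assumes "adj_regular n d a"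
  shows "(\<Sum>u<n. \<Sum>r<d. \<phi> (a ! u ! r)) = real d * (\<Sum>q<n. \<phi> q)"
proof -
  have "(\<Sum>r<d. \<phi> (a ! u ! r)) = (\<Sum>q | q \<in> {..<n} \<and> q \<in> set (a ! u). \<phi> q)" if "u < n" for u
  proof -
    have *: "length (a ! u) = d" "distinct (a ! u)" "set (a ! u) \<subseteq> {..<n}"
      using assms that by (auto simp: adj_regular_def)
    then have "{q. q \<in> {..<n} \<and> q \<in> set (a ! u)} = set (a ! u)" by auto
    moreover have "bij_betw (nth (a ! u)) {..<d} (set (a ! u))"
      using * by (intro bij_betw_nth) auto
    ultimately show ?thesis
      by (simp add: sum.reindex_bij_betw)
  qed
  then have "(\<Sum>u<n. \<Sum>r<d. \<phi> (a ! u ! r)) =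
      (\<Sum>u<n. \<Sum>q | q \<in> {..<n} \<and> q \<in> set (a ! u). \<phi> q)"
    by simp
  also have "\<dots> = (\<Sum>q<n. \<Sum>u | u \<in> {..<n} \<and> q \<in> set (a ! u). \<phi> q)"
    by (rule sum.swap_restrict) auto
  also have "\<dots> = (\<Sum>q<n. real d * \<phi> q)"
    using assms by (intro sum.cong) (auto simp: adj_regular_def)
  finally show ?thesis by (simp add: sum_distrib_left)
qed

text \<open>\<open>g\<close> maps the matched vertices of \<open>Q\<close> bijectively onto the
  successors of the vertices outside \<open>F\<close>, with inverse given by \<open>f\<close>; free
  vertices contribute \<open>\<psi> 0 = 0\<close>.\<close>

lemma sum_matched:
  fixes \<psi> :: "nat \<Rightarrow> real"
  assumes "partial_matching n a F f g" and "\<psi> 0 = 0"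
  shows "(\<Sum>q<n. \<psi> (g q)) = (\<Sum>u\<in>{..<n} - F. \<psi> (Suc u))"
proof -
  have "(\<Sum>q<n. \<psi> (g q)) = (\<Sum>q\<in>{q. q < n \<and> g q \<noteq> 0}. \<psi> (g q))"
    by (rule sum.mono_neutral_right) (use assms(2) in auto)
  also have "\<dots> = (\<Sum>u\<in>{..<n} - F. \<psi> (Suc u))"
    by (rule sum.reindex_bij_witness[where j = "\<lambda>q. g q - 1" and i = f])
      (use assms(1) in \<open>auto simp: partial_matching_def\<close>)
  finally show ?thesis .
qed

text \<open>
  Summing the recursion for the mean length over all starting vertices, the in-degree of every
  matched vertex balances its out-degree, so only the unmatched starting vertices remain.
\<close>

lemma sum_mean_len_unmatched:
  assumes "adj_regular n d a" and "d > 0" and "partial_matching n a F f g" and "F \<subseteq> {..<n}"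
  shows "(\<Sum>u\<in>F. mean_len d a g L (Suc u)) \<le> real n"
proof -
  let ?h = "mean_len d a g"
  \<comment> \<open>The longer cutoff permits one unfolding of the recursion, whose right-hand side
    again has cutoff \<open>L\<close>; the terms outside \<open>F\<close> then cancel.\<close>
  have "(\<Sum>u<n. ?h L (Suc u)) \<le> (\<Sum>u<n. ?h (Suc L) (Suc u))"
    by (intro sum_mono mean_len_mono)
  also have "\<dots> = real n + (\<Sum>u<n. \<Sum>r<d. ?h L (g (a ! u ! r))) / real d"
    by (simp add: sum.distrib sum_divide_distrib)
  also have "\<dots> = real n + (\<Sum>u\<in>{..<n} - F. ?h L (Suc u))"
    using assms(2) sum_adjacent[OF assms(1), of "\<lambda>q. ?h L (g q)"]
      sum_matched[OF assms(3), of "?h L"] by simp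
  finally show ?thesis
    using sum.subset_diff[OF assms(4), of "\<lambda>u. ?h L (Suc u)"] by simp
qed

section \<open>Fixing the random choices by averaging\<close>

lemma exists_le_average:
  fixes K :: "'a \<Rightarrow> real"
  assumes "finite I" and "I \<noteq> {}"
  shows "\<exists>i\<in>I. K i \<le> (\<Sum>i\<in>I. K i) / real (card I)"
proof (rule ccontr)
  assume "\<not> ?thesis"
  then have "(\<Sum>i\<in>I. (\<Sum>i\<in>I. K i) / real (card I)) < (\<Sum>i\<in>I. K i)"
    using assms by (intro sum_strict_mono) (auto simp: not_le)
  then show False using assms by simp
qed

text \<open>The method of conditional expectations: the random choices are fixed one at a time.\<close>

lemma exists_choices:
  fixes p :: "'x \<Rightarrow> real"
  assumes "d > 0"
  shows "\<exists>rs. length rs = L \<and> set rs \<subseteq> {..<d} \<and>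
           (\<Sum>x\<in>X. p x * real (walk_len (a x) (g x) rs (c x))) \<le>
           (\<Sum>x\<in>X. p x * mean_len d (a x) (g x) L (c x))"
proof (induction L arbitrary: c)
  case 0
  show ?case by simp
next
  case (Suc L)
  \<comment> \<open>After the common choice \<open>r\<close> the walks on different inputs stand at
    different positions, so the induction needs arbitrary \<open>c\<close>. A finished walk stays at
    \<open>0\<close>.\<close>
  define c' where "c' r x = (if c x = 0 then 0 else g x (a x ! (c x - 1) ! r))" for r x
  define K where "K r = (\<Sum>x\<in>X. p x * (of_bool (c x \<noteq> 0) + mean_len d (a x) (g x) L (c' r x)))"
    for r
  obtain r where r: "r < d" "K r \<le> (\<Sum>r<d. K r) / real d"
    using exists_le_average[of "{..<d}" K] assms by auto
  have "(\<Sum>r<d. K r) / real d =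
      (\<Sum>x\<in>X. (\<Sum>r<d. p x * (of_bool (c x \<noteq> 0) + mean_len d (a x) (g x) L (c' r x))) / real d)"
    unfolding K_def by (subst sum.swap) (simp add: sum_divide_distrib)
  also have "\<dots> = (\<Sum>x\<in>X. p x * mean_len d (a x) (g x) (Suc L) (c x))"
    using assms by (intro sum.cong)
      (auto simp: c'_def sum.distrib add_divide_distrib distrib_left simp flip: sum_distrib_left)
  finally have avg: "K r \<le> (\<Sum>x\<in>X. p x * mean_len d (a x) (g x) (Suc L) (c x))"
    using r by simp
  obtain rs where rs: "length rs = L" "set rs \<subseteq> {..<d}"
    "(\<Sum>x\<in>X. p x * real (walk_len (a x) (g x) rs (c' r x))) \<le>
     (\<Sum>x\<in>X. p x * mean_len d (a x) (g x) L (c' r x))"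
    using Suc.IH by blast
  have zero: "walk_len a g rs 0 = 0" for a g by (cases rs) auto
  have "(\<Sum>x\<in>X. p x * real (walk_len (a x) (g x) (r # rs) (c x))) =
      (\<Sum>x\<in>X. p x * of_bool (c x \<noteq> 0)) + (\<Sum>x\<in>X. p x * real (walk_len (a x) (g x) rs (c' r x)))"
    unfolding sum.distrib[symmetric]
    by (intro sum.cong) (auto simp: c'_def zero distrib_left)
  also have "\<dots> \<le> K r"
    using rs(3) by (simp add: K_def distrib_left sum.distrib)
  finally show ?case
    using avg rs(1,2) r(1) by (intro exI[of _ "r # rs"]) (auto simp del: walk_len.simps)
qed

text \<open>On each input the mean lengths from the vertices of \<open>F\<close> add up to at most
  \<open>n\<close>, so the weighted total, averaged over \<open>F\<close>, is at most
  \<open>B\<close>, and one start serves all inputs together. With enough choices every walk ends: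
  an unfinished one would exceed \<open>B\<close> by its own positive weight.\<close>

lemma exists_start_choices:
  fixes p :: "'x \<Rightarrow> real"
  assumes "finite X" and "\<And>x. x \<in> X \<Longrightarrow> p x > 0"
    and "d > 0" and "\<And>x. x \<in> X \<Longrightarrow> adj_regular n d (a x)"
    and "\<And>x. x \<in> X \<Longrightarrow> partial_matching n (a x) F (f x) (g x)"
    and "F \<subseteq> {..<n}" and "F \<noteq> {}"
  shows "\<exists>u\<in>F. \<exists>rs. set rs \<subseteq> {..<d} \<and>
           (\<Sum>x\<in>X. p x * real (walk_len (a x) (g x) rs (Suc u))) \<le>
             (\<Sum>x\<in>X. p x) * (real n / real (card F)) \<and>
           (\<forall>x\<in>X. walk_len (a x) (g x) rs (Suc u) < length rs)"
proof -
  have finF: "finite F" using assms(6) by (rule finite_subset) auto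
  define B where "B = (\<Sum>x\<in>X. p x) * (real n / real (card F))"
  \<comment> \<open>The sum dominates every single \<open>B / p x\<close>, and \<open>Suc\<close>
    makes the bound on the length strict.\<close>
  define L where "L = Suc (nat \<lceil>\<Sum>x\<in>X. B / p x\<rceil>)"
  have B: "B \<ge> 0" unfolding B_def
    by (intro mult_nonneg_nonneg sum_nonneg) (use assms(2) in \<open>auto simp: less_imp_le\<close>)
  let ?K = "\<lambda>u. \<Sum>x\<in>X. p x * mean_len d (a x) (g x) L (Suc u)"
  have "(\<Sum>u\<in>F. ?K u) = (\<Sum>x\<in>X. p x * (\<Sum>u\<in>F. mean_len d (a x) (g x) L (Suc u)))"
    by (subst sum.swap) (simp add: sum_distrib_left)
  also have "\<dots> \<le> (\<Sum>x\<in>X. p x * real n)"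
    by (intro sum_mono mult_left_mono sum_mean_len_unmatched)
      (use assms in \<open>auto simp: less_imp_le\<close>)
  finally have le: "(\<Sum>u\<in>F. ?K u) / real (card F) \<le> B"
    by (simp add: B_def sum_distrib_right divide_right_mono)
  obtain u where u: "u \<in> F" "?K u \<le> B"
    using exists_le_average[OF finF assms(7), of ?K] le by force
  obtain rs where rs: "length rs = L" "set rs \<subseteq> {..<d}"
    "(\<Sum>x\<in>X. p x * real (walk_len (a x) (g x) rs (Suc u))) \<le> B"
    using exists_choices[OF assms(3), where c = "\<lambda>_. Suc u"] u(2) order_trans by blast
  have "walk_len (a x) (g x) rs (Suc u) < L" if x: "x \<in> X" for x
  proof -
    have "p x * real (walk_len (a x) (g x) rs (Suc u)) \<le> B"
      by (rule order_trans[OF member_le_sum rs(3)]) (use x assms(1,2) in \<open>auto simp: less_imp_le\<close>)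
    then have "real (walk_len (a x) (g x) rs (Suc u)) \<le> B / p x"
      using assms(2)[OF x] by (simp add: field_simps)
    also have "\<dots> \<le> (\<Sum>x\<in>X. B / p x)"
      by (rule member_le_sum) (use x assms(1,2) B in \<open>auto simp: less_imp_le\<close>)
    also have "\<dots> < real L" unfolding L_def by linarith
    finally show ?thesis by simp
  qed
  then show ?thesis
    using u(1) rs unfolding B_def[symmetric] by (auto intro!: bexI[of _ u] exI[of _ rs])
qed

section \<open>The walk and augmentation programs\<close>

text \<open>Memory layout: arrays \<open>0\<close> and \<open>1\<close> hold \<open>f\<close> and
  \<open>g\<close>, cell \<open>c\<close> of array \<open>2\<close> the latest exit from position
  \<open>c\<close>, cell \<open>0\<close> of array \<open>3\<close> the current position, cell
  \<open>0\<close> of array \<open>4\<close> a saved old partner.\<close>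

abbreviation cur :: expr where "cur \<equiv> Cell 3 (Const 0)"

abbreviation cur_vertex :: expr where "cur_vertex \<equiv> Op Sub cur (Const 1)"

text \<open>The choices are unrolled into nested conditionals, so a finished walk skips all
  remaining ones after a single failed test: the cost depends on the steps made, not on the length
  of \<open>rs\<close>.\<close>

fun walk :: "nat list \<Rightarrow> prog" where
  "walk [] = Skip"
| "walk (r # rs) =
     If cur
       (Seq (Seq (Store 2 cur (Neighbour PSide cur_vertex (Const r)))
                 (Store 3 (Const 0) (Cell 1 (Cell 2 cur))))
            (walk rs))
       Skip"

text \<open>Retraces the latest exits, giving each \<open>v\<close> on the way to the vertex in
  hand. The old partner is saved in array \<open>4\<close> before array \<open>1\<close> is
  overwritten.\<close>

definition augment :: prog where
  "augment =
     While cur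
       (Seq (Store 0 cur_vertex (Cell 2 cur))
       (Seq (Store 4 (Const 0) (Cell 1 (Cell 2 cur)))
       (Seq (Store 1 (Cell 2 cur) cur)
            (Store 3 (Const 0) (Cell 4 (Const 0))))))"

definition phase :: "nat \<Rightarrow> nat list \<Rightarrow> prog" where
  "phase u rs =
     Seq (Store 3 (Const 0) (Const (Suc u)))
    (Seq (walk rs)
    (Seq (Store 3 (Const 0) (Const (Suc u)))
         augment))"

text \<open>
  \<open>S\<close> collects the visited vertices and \<open>\<rho>\<close> the times of their latest visits. Following the latest
  exits \<open>nx\<close> increases \<open>\<rho>\<close>, so it leads from the start to a free vertex along a simple path.
\<close>

definition walk_inv ::
  "nat \<Rightarrow> nat list list \<Rightarrow> (nat \<Rightarrow> nat) \<Rightarrow> (nat \<Rightarrow> nat) \<Rightarrow> nat \<Rightarrow> nat set \<Rightarrow> (nat \<Rightarrow> nat) \<Rightarrow> nat \<Rightarrow> bool"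
where
  "walk_inv n a g nx j S \<rho> c \<longleftrightarrow>
     S \<subseteq> {1..n} \<and> (\<forall>x\<in>S. \<rho> x \<le> j) \<and> (c \<noteq> 0 \<longrightarrow> c \<in> S \<and> \<rho> c = j) \<and>
     (\<forall>x\<in>S - {c}. nx x \<in> set (a ! (x - 1)) \<and>
        (g (nx x) \<noteq> 0 \<longrightarrow> g (nx x) \<in> S \<and> \<rho> x < \<rho> (g (nx x))))"

text \<open>The new position gets a time later than all earlier ones, so exits leading to it still
  increase \<open>\<rho>\<close>. A free \<open>v\<close> adds no vertex.\<close>

lemma walk_inv_step:
  assumes "walk_inv n a g nx j S \<rho> c" and "c \<noteq> 0" and "v \<in> set (a ! (c - 1))" and "g v \<le> n"
  shows "\<exists>S' \<rho>'. S \<subseteq> S' \<and> walk_inv n a g (nx(c := v)) (Suc j) S' \<rho>' (g v)"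
proof (cases "g v = 0")
  case True
  then have "walk_inv n a g (nx(c := v)) (Suc j) S \<rho> (g v)"
    using assms by (auto simp: walk_inv_def le_Suc_eq)
  then show ?thesis by blast
next
  case False
  then have "walk_inv n a g (nx(c := v)) (Suc j) (insert (g v) S) (\<rho>(g v := Suc j)) (g v)"
    using assms by (auto simp: walk_inv_def le_Suc_eq less_Suc_eq_le)
  then show ?thesis by blast
qed

lemma exec_Store:
  assumes "expr_val w A m e1 = i" and "expr_val w A m e2 = v" and "t = 1 + expr_cost e1 + expr_cost e2"
  shows "exec w A (Store a e1 e2) m t (m(a := (m a)(i := v)))"
  using exec.Store[of w A a e1 e2 m] assms by simp

text \<open>A step costs \<open>18 = 3 + 9 + 6\<close>, for the test and two stores;
  \<open>4\<close> covers the last test and \<open>Skip\<close>. A walk making fewer steps than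
  there are choices must have reached position \<open>0\<close>.\<close>

lemma exec_walk:
  assumes "adj_regular n d (A PSide)" and "n < 2 ^ w" and "set rs \<subseteq> {..<d}"
    and "\<forall>q<n. m 1 q \<le> n"
    and "walk_inv n (A PSide) (m 1) (m 2) j S \<rho> (m 3 0)"
  shows "\<exists>t m' j' S' \<rho>'. exec w A (walk rs) m t m' \<and> m' 0 = m 0 \<and> m' 1 = m 1 \<and> S \<subseteq> S' \<and>
           walk_inv n (A PSide) (m 1) (m' 2) j' S' \<rho>' (m' 3 0) \<and>
           j' \<le> j + walk_len (A PSide) (m 1) rs (m 3 0) \<and>
           t \<le> 18 * walk_len (A PSide) (m 1) rs (m 3 0) + 4 \<and>
           (walk_len (A PSide) (m 1) rs (m 3 0) < length rs \<longrightarrow> m' 3 0 = 0)"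
  using assms(3-5)
proof (induction rs arbitrary: m j S \<rho>)
  case Nil
  then show ?case using exec.Skip by fastforce
next
  case (Cons r rs)
  let ?a = "A PSide"
  show ?case
  proof (cases "m 3 0 = 0")
    case True
    then have "exec w A (walk (r # rs)) m (1 + expr_cost cur + 1) m"
      unfolding walk.simps by (intro exec.IfFalse exec.Skip) simp
    with True Cons.prems(3) show ?thesis
      by (intro exI[of _ "1 + expr_cost cur + 1"] exI[of _ m] exI[of _ j] exI[of _ S] exI[of _ \<rho>]) simp
  next
    case False
    define c where "c = m 3 0"
    define v where "v = ?a ! (c - 1) ! r"
    have c: "c \<noteq> 0" "c - 1 < n" "c \<le> n"
      using False Cons.prems(3) by (auto simp: c_def walk_inv_def)
    have r: "r < d" using Cons.prems(1) by auto
    have "length (?a ! (c - 1)) = d" "length ?a = n" "set (?a ! (c - 1)) \<subseteq> {..<n}"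
      using assms(1) c(2) by (auto simp: adj_regular_def)
    moreover have v: "v \<in> set (?a ! (c - 1))"
      unfolding v_def using r calculation by simp
    ultimately have len: "length (?a ! (c - 1)) = d" "length ?a = n" and vn: "v < n"
      by auto
    \<comment> \<open>By \<open>d \<le> n < 2 ^ w\<close> the constant \<open>r\<close> survives
      truncation; \<open>0 < w\<close> does the same for the constant \<open>1\<close>.\<close>
    have dn: "d \<le> n"
      using len(1) assms(1) c(2) card_mono[of "{..<n}" "set (?a ! (c - 1))"]
      by (auto simp: adj_regular_def distinct_card)
    have pos: "0 < w"
      using c assms(2) by (cases w) auto
    define m1 where "m1 = m(2 := (m 2)(c := v))"
    define m2 where "m2 = m1(3 := (m1 3)(0 := m 1 v))"
    have e1: "expr_val w A m cur = c" "expr_val w A m1 cur = c"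
      by (simp_all add: c_def m1_def)
    have "expr_val w A m cur_vertex = c - 1" "expr_val w A m (Const r) = r"
      using c r dn pos assms(2) by (simp_all add: c_def[symmetric])
    then have e2: "expr_val w A m (Neighbour PSide cur_vertex (Const r)) = v"
      using c r len vn assms(2) unfolding expr_val.simps(5) Let_def v_def by simp
    have e3: "expr_val w A m1 (Cell 1 (Cell 2 cur)) = m 1 v" "expr_val w A m1 (Const 0) = 0"
      by (simp_all add: m1_def c_def)
    have "exec w A (Store 2 cur (Neighbour PSide cur_vertex (Const r))) m 9 m1"
      unfolding m1_def by (rule exec_Store[OF e1(1) e2]) simp
    moreover have "exec w A (Store 3 (Const 0) (Cell 1 (Cell 2 cur))) m1 6 m2"
      unfolding m2_def by (rule exec_Store[OF e3(2,1)]) simp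
    ultimately have step: "exec w A (Seq (Store 2 cur (Neighbour PSide cur_vertex (Const r)))
        (Store 3 (Const 0) (Cell 1 (Cell 2 cur)))) m (9 + 6) m2"
      by (rule exec.Seq)
    have m2: "m2 0 = m 0" "m2 1 = m 1" "m2 2 = (m 2)(c := v)" "m2 3 0 = m 1 v"
      by (simp_all add: m1_def m2_def)
    have "m 1 v \<le> n" using Cons.prems(2) vn by blast
    then obtain S1 \<rho>1 where S1: "S \<subseteq> S1"
      "walk_inv n ?a (m 1) ((m 2)(c := v)) (Suc j) S1 \<rho>1 (m 1 v)"
      using walk_inv_step[OF Cons.prems(3)[folded c_def] c(1) v] by blast
    have prems: "set rs \<subseteq> {..<d}" "\<forall>q<n. m2 1 q \<le> n"
      "walk_inv n ?a (m2 1) (m2 2) (Suc j) S1 \<rho>1 (m2 3 0)"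
      using Cons.prems S1(2) unfolding m2 by auto
    obtain t m' j' S' \<rho>' where IH: "exec w A (walk rs) m2 t m'" "m' 0 = m 0" "m' 1 = m 1"
      "S1 \<subseteq> S'" "walk_inv n ?a (m 1) (m' 2) j' S' \<rho>' (m' 3 0)"
      "j' \<le> Suc j + walk_len ?a (m 1) rs (m 1 v)"
      "t \<le> 18 * walk_len ?a (m 1) rs (m 1 v) + 4"
      "walk_len ?a (m 1) rs (m 1 v) < length rs \<longrightarrow> m' 3 0 = 0"
      using Cons.IH[OF prems] unfolding m2 by blast
    have "exec w A (walk (r # rs)) m (1 + expr_cost cur + (9 + 6 + t)) m'"
      unfolding walk.simps
      by (rule exec.IfTrue[OF _ exec.Seq[OF step IH(1)]]) (use c(1) e1 in simp)
    moreover have "walk_len ?a (m 1) (r # rs) (m 3 0) = Suc (walk_len ?a (m 1) rs (m 1 v))"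
      using c(1) by (simp add: c_def[symmetric] v_def)
    ultimately show ?thesis
      using IH S1(1)
      by (intro exI[of _ "1 + expr_cost cur + (9 + 6 + t)"] exI[of _ m'] exI[of _ j'] exI[of _ S']
          exI[of _ \<rho>']) auto
  qed
qed

text \<open>
  No global statement about the path is needed: moving \<open>v\<close> from its partner \<open>g v - 1\<close> to the vertex
  in hand \<open>c - 1\<close> keeps a partial matching, with \<open>g v - 1\<close> as the new vertex in hand.
\<close>

lemma partial_matching_exchange:
  assumes "partial_matching n a (F \<union> {p. Suc p = c}) f g"
    and "c \<noteq> 0" and "c \<le> n" and "c - 1 \<notin> F" and "v < n" and "v \<in> set (a ! (c - 1))"
  shows "partial_matching n a (F \<union> {p. Suc p = g v}) (f(c - 1 := v)) (g(v := c))"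
    and "g v \<noteq> 0 \<Longrightarrow> g v - 1 \<notin> F"
proof -
  have P: "\<And>p. p < n \<Longrightarrow> p \<notin> F \<Longrightarrow> Suc p \<noteq> c \<Longrightarrow> f p < n \<and> f p \<in> set (a ! p) \<and> g (f p) = Suc p"
    and Q: "\<And>q. q < n \<Longrightarrow> g q \<noteq> 0 \<Longrightarrow> g q \<le> n \<and> g q - 1 \<notin> F \<and> g q \<noteq> c \<and> f (g q - 1) = q"
    using assms(1) by (auto simp: partial_matching_def)
  show "g v \<noteq> 0 \<Longrightarrow> g v - 1 \<notin> F" using Q assms(5) by blast
  show "partial_matching n a (F \<union> {p. Suc p = g v}) (f(c - 1 := v)) (g(v := c))"
    unfolding partial_matching_def
  proof (rule conjI; rule allI, rule impI, rule impI)
    fix p assume p: "p < n" "p \<notin> F \<union> {p. Suc p = g v}"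
    show "(f(c - 1 := v)) p < n \<and> (f(c - 1 := v)) p \<in> set (a ! p) \<and>
        (g(v := c)) ((f(c - 1 := v)) p) = Suc p"
    proof (cases "p = c - 1")
      case True
      then show ?thesis using assms by simp
    next
      case False
      then have "Suc p \<noteq> c" by auto
      then have "f p < n" "f p \<in> set (a ! p)" "g (f p) = Suc p" using P[of p] p by auto
      moreover from this have "f p \<noteq> v" using p(2) by auto
      ultimately show ?thesis using False by simp
    qed
  next
    fix q assume q: "q < n" "(g(v := c)) q \<noteq> 0"
    show "(g(v := c)) q \<le> n \<and> (g(v := c)) q - 1 \<notin> F \<union> {p. Suc p = g v} \<and>
        (f(c - 1 := v)) ((g(v := c)) q - 1) = q"
    proof (cases "q = v")
      case True
      then show ?thesis using assms Q[of v] by auto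
    next
      case False
      then have *: "g q \<noteq> 0" "g q \<le> n" "g q - 1 \<notin> F" "g q \<noteq> c" "f (g q - 1) = q"
        using q Q[of q] by auto
      have "g q \<noteq> g v"
        using * False Q[of v] assms(5) by auto
      moreover have "g q - 1 \<noteq> c - 1" using * assms(2) by linarith
      ultimately show ?thesis using * False by auto
    qed
  qed
qed

text \<open>Induction on the remaining time \<open>j - \<rho> (m 3 0)\<close>, which drops because
  exits increase \<open>\<rho>\<close>. The path condition is imposed only from the current time on,
  since after a switch the exit of \<open>c\<close> leads back to \<open>c\<close> itself. A round
  costs \<open>27 = 3 + 24\<close>, the final test \<open>3\<close> more.\<close>

lemma exec_augment:
  assumes "adj_regular n d (A PSide)" and "n < 2 ^ w" and "S \<subseteq> {1..n}"
    and "\<forall>x\<in>S. \<rho> x \<le> j" and "\<forall>x\<in>S. m 2 x \<in> set (A PSide ! (x - 1))"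
    and "m 3 0 \<in> S" and "m 3 0 - 1 \<notin> F"
    and "\<forall>x\<in>S. \<rho> (m 3 0) \<le> \<rho> x \<longrightarrow> m 1 (m 2 x) \<noteq> 0 \<longrightarrow>
           m 1 (m 2 x) \<in> S \<and> \<rho> x < \<rho> (m 1 (m 2 x))"
    and "partial_matching n (A PSide) (F \<union> {p. Suc p = m 3 0}) (m 0) (m 1)"
  shows "\<exists>t m'. exec w A augment m t m' \<and> t \<le> 27 * (j - \<rho> (m 3 0)) + 30 \<and>
           partial_matching n (A PSide) F (m' 0) (m' 1)"
  using assms(5-9)
proof (induction "j - \<rho> (m 3 0)" arbitrary: m rule: less_induct)
  case less
  let ?a = "A PSide"
  define c where "c = m 3 0"
  define v where "v = m 2 c"
  define m1 where "m1 = m(0 := (m 0)(c - 1 := v))"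
  define m2 where "m2 = m1(4 := (m1 4)(0 := m 1 v))"
  define m3 where "m3 = m2(1 := (m2 1)(v := c))"
  define m4 where "m4 = m3(3 := (m3 3)(0 := m 1 v))"
  let ?body = "Seq (Store 0 cur_vertex (Cell 2 cur))
       (Seq (Store 4 (Const 0) (Cell 1 (Cell 2 cur)))
       (Seq (Store 1 (Cell 2 cur) cur)
            (Store 3 (Const 0) (Cell 4 (Const 0)))))"
  have "c \<in> {1..n}" using less.prems(2) assms(3) unfolding c_def by blast
  then have c: "c \<in> S" "c \<noteq> 0" "c \<le> n" "c - 1 < n" "c - 1 \<notin> F"
    using less.prems(2,3) by (auto simp: c_def)
  have v: "v \<in> set (?a ! (c - 1))" using less.prems(1) c(1) by (auto simp: v_def)
  then have vn: "v < n" using assms(1) c(4) by (auto simp: adj_regular_def)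
  have pos: "0 < w" using c assms(2) by (cases w) auto
  have m4: "m4 0 = (m 0)(c - 1 := v)" "m4 1 = (m 1)(v := c)" "m4 2 = m 2" "m4 3 0 = m 1 v"
    by (simp_all add: m1_def m2_def m3_def m4_def)
  have e: "expr_val w A m cur = c" "expr_val w A m (Cell 2 cur) = v"
    "expr_val w A m cur_vertex = c - 1" "expr_val w A m1 (Cell 1 (Cell 2 cur)) = m 1 v"
    "expr_val w A m2 (Cell 2 cur) = v" "expr_val w A m2 cur = c"
    "expr_val w A m3 (Cell 4 (Const 0)) = m 1 v"
    "expr_val w A m1 (Const 0) = 0" "expr_val w A m3 (Const 0) = 0"
    using c pos assms(2)
    by (simp_all add: c_def[symmetric] v_def[symmetric] m1_def m2_def m3_def)
  have "exec w A (Store 0 cur_vertex (Cell 2 cur)) m 8 m1"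
    unfolding m1_def by (rule exec_Store[OF e(3,2)]) simp
  moreover have "exec w A (Store 4 (Const 0) (Cell 1 (Cell 2 cur))) m1 6 m2"
    unfolding m2_def by (rule exec_Store[OF e(8,4)]) simp
  moreover have "exec w A (Store 1 (Cell 2 cur) cur) m2 6 m3"
    unfolding m3_def by (rule exec_Store[OF e(5,6)]) simp
  moreover have "exec w A (Store 3 (Const 0) (Cell 4 (Const 0))) m3 4 m4"
    unfolding m4_def by (rule exec_Store[OF e(9,7)]) simp
  ultimately have "exec w A ?body m (8 + (6 + (6 + 4))) m4"
    by (intro exec.Seq)
  then have body: "exec w A ?body m 24 m4" by simp
  have test: "expr_val w A m cur \<noteq> 0" using c(2) e(1) by simp
  note ex = partial_matching_exchange[OF less.prems(5)[folded c_def] c(2,3,5) vn v]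
  show ?case
  proof (cases "m 1 v = 0")
    case True
    then have "exec w A augment m4 (1 + expr_cost cur) m4"
      unfolding augment_def by (intro exec.WhileFalse) (simp add: m4)
    then have "exec w A augment m (1 + expr_cost cur + 24 + (1 + expr_cost cur)) m4"
      using exec.WhileTrue[OF test body] unfolding augment_def by blast
    \<comment> \<open>As \<open>v\<close> was free, no vertex remains in hand:
      \<open>{p. Suc p = m 1 v}\<close> is empty.\<close>
    moreover have "partial_matching n ?a F (m4 0) (m4 1)"
      using ex(1) True unfolding m4 by simp
    ultimately show ?thesis
      by (intro exI[of _ "1 + expr_cost cur + 24 + (1 + expr_cost cur)"] exI[of _ m4]) simp
  next
    case False
    have next': "m 1 v \<in> S" "\<rho> c < \<rho> (m 1 v)"
      using less.prems(4) c(1) False by (auto simp: v_def c_def)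
    have dec: "Suc (j - \<rho> (m4 3 0)) \<le> j - \<rho> (m 3 0)"
      using next' assms(4) unfolding m4 c_def[symmetric] by (meson Suc_leI diff_less_mono2 le_less_trans less_le_trans)
    have "\<exists>t m'. exec w A augment m4 t m' \<and> t \<le> 27 * (j - \<rho> (m4 3 0)) + 30 \<and>
           partial_matching n ?a F (m' 0) (m' 1)"
    proof (rule less.hyps)
      show "j - \<rho> (m4 3 0) < j - \<rho> (m 3 0)" using dec by simp
      show "\<forall>x\<in>S. m4 2 x \<in> set (?a ! (x - 1))" using less.prems(1) by (simp add: m4)
      show "m4 3 0 \<in> S" using next' by (simp add: m4)
      show "m4 3 0 - 1 \<notin> F" using ex(2) False by (simp add: m4)
      show "partial_matching n ?a (F \<union> {p. Suc p = m4 3 0}) (m4 0) (m4 1)"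
        unfolding m4 by (rule ex(1))
      show "\<forall>x\<in>S. \<rho> (m4 3 0) \<le> \<rho> x \<longrightarrow> m4 1 (m4 2 x) \<noteq> 0 \<longrightarrow>
          m4 1 (m4 2 x) \<in> S \<and> \<rho> x < \<rho> (m4 1 (m4 2 x))"
      proof (intro ballI impI)
        fix x assume x: "x \<in> S" "\<rho> (m4 3 0) \<le> \<rho> x" "m4 1 (m4 2 x) \<noteq> 0"
        have *: "m 1 (m 2 x) \<noteq> 0 \<longrightarrow> m 1 (m 2 x) \<in> S \<and> \<rho> x < \<rho> (m 1 (m 2 x))"
          using less.prems(4) x(1,2) next'(2) unfolding c_def[symmetric] m4 by auto
        \<comment> \<open>A vertex \<open>x\<close> with exit \<open>v\<close> would satisfy
          \<open>\<rho> x < \<rho> (m 1 v)\<close>, against the choice of \<open>x\<close>; so the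
          overwritten entry of \<open>g\<close> is not met again.\<close>
        then have "m 2 x \<noteq> v" using False x(2) unfolding m4 by auto
        then show "m4 1 (m4 2 x) \<in> S \<and> \<rho> x < \<rho> (m4 1 (m4 2 x))"
          using * x(3) unfolding m4 by simp
      qed
    qed
    then obtain t m' where t: "exec w A augment m4 t m'" "t \<le> 27 * (j - \<rho> (m4 3 0)) + 30"
      "partial_matching n ?a F (m' 0) (m' 1)" by blast
    have "exec w A augment m (1 + expr_cost cur + 24 + t) m'"
      using exec.WhileTrue[OF test body] t(1) unfolding augment_def by blast
    then show ?thesis
      using t(2,3) dec by (intro exI[of _ "1 + expr_cost cur + 24 + t"] exI[of _ m']) simp
  qed
qed

section \<open>One phase, and the program for a fixed degree\<close>

text \<open>The walk length bounds both the steps made and the latest visit time \<open>j\<close>,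
  whence \<open>45 = 18 + 27\<close>; the rest is \<open>40 = 3 + 4 + 3 + 30\<close>.\<close>

lemma exec_phase:
  assumes "adj_regular n d (A PSide)" and "n < 2 ^ w" and "set rs \<subseteq> {..<d}"
    and "partial_matching n (A PSide) F (m 0) (m 1)" and "u \<in> F" and "F \<subseteq> {..<n}"
    and "walk_len (A PSide) (m 1) rs (Suc u) < length rs"
  shows "\<exists>t m'. exec w A (phase u rs) m t m' \<and>
           t \<le> 45 * walk_len (A PSide) (m 1) rs (Suc u) + 40 \<and>
           partial_matching n (A PSide) (F - {u}) (m' 0) (m' 1)"
proof -
  let ?a = "A PSide"
  let ?l = "walk_len ?a (m 1) rs (Suc u)"
  have u: "Suc u \<le> n" "Suc u < 2 ^ w" using assms by auto
  have start: "exec w A (Store 3 (Const 0) (Const (Suc u))) m 3 (m(3 := (m 3)(0 := Suc u)))" for m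
    by (rule exec_Store) (use u in simp_all)
  define m1 where "m1 = m(3 := (m 3)(0 := Suc u))"
  have m1: "m1 0 = m 0" "m1 1 = m 1" "m1 3 0 = Suc u" by (simp_all add: m1_def)
  have "walk_inv n ?a (m1 1) (m1 2) 0 {Suc u} (\<lambda>_. 0) (m1 3 0)"
    using u m1 by (simp add: walk_inv_def)
  moreover have "\<forall>q<n. m1 1 q \<le> n"
    using assms(4) m1 by (force simp: partial_matching_def)
  ultimately obtain t m2 j S \<rho> where walk: "exec w A (walk rs) m1 t m2" "m2 0 = m 0" "m2 1 = m 1"
    "Suc u \<in> S" "walk_inv n ?a (m 1) (m2 2) j S \<rho> (m2 3 0)" "j \<le> ?l" "t \<le> 18 * ?l + 4" "m2 3 0 = 0"
    using exec_walk[where n = n and w = w and A = A and m = m1 and j = 0 and S = "{Suc u}" and \<rho> = "\<lambda>_. 0",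
        OF assms(1) assms(2) assms(3)] assms(7) unfolding m1 by auto
  define m3 where "m3 = m2(3 := (m2 3)(0 := Suc u))"
  have m3: "m3 0 = m 0" "m3 1 = m 1" "m3 2 = m2 2" "m3 3 0 = Suc u"
    using walk by (simp_all add: m3_def)
  \<comment> \<open>The final position \<open>0\<close> lies outside \<open>S\<close>, so the
    exemption of the current position is void and every visited vertex has a recorded exit.\<close>
  have inv: "walk_inv n ?a (m 1) (m2 2) j S \<rho> 0" using walk(5,8) by simp
  then have S: "S - {0} = S" "S \<subseteq> {1..n}" by (auto simp: walk_inv_def)
  have path: "\<forall>x\<in>S. \<rho> x \<le> j" "\<forall>x\<in>S. m3 2 x \<in> set (?a ! (x - 1))"
    "\<forall>x\<in>S. \<rho> (m3 3 0) \<le> \<rho> x \<longrightarrow> m3 1 (m3 2 x) \<noteq> 0 \<longrightarrow>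
       m3 1 (m3 2 x) \<in> S \<and> \<rho> x < \<rho> (m3 1 (m3 2 x))"
    using inv unfolding m3 walk_inv_def S(1) by blast+
  have "\<exists>t m'. exec w A augment m3 t m' \<and> t \<le> 27 * (j - \<rho> (m3 3 0)) + 30 \<and>
           partial_matching n ?a (F - {u}) (m' 0) (m' 1)"
  proof (rule exec_augment[where n = n and d = d and w = w and A = A and S = S,
          OF assms(1) assms(2) S(2)])
    have "F - {u} \<union> {p. Suc p = Suc u} = F" using assms(5) by auto
    then show "partial_matching n ?a (F - {u} \<union> {p. Suc p = m3 3 0}) (m3 0) (m3 1)"
      using assms(4) m3 by simp
    show "m3 3 0 \<in> S" "m3 3 0 - 1 \<notin> F - {u}" using walk(4) m3 by auto
  qed (fact path)+
  then obtain t' m' where aug: "exec w A augment m3 t' m'" "t' \<le> 27 * (j - \<rho> (m3 3 0)) + 30"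
    "partial_matching n ?a (F - {u}) (m' 0) (m' 1)" by blast
  have "exec w A (phase u rs) m (3 + (t + (3 + t'))) m'"
    unfolding phase_def
    by (rule exec.Seq[OF start[of m, folded m1_def]
          exec.Seq[OF walk(1) exec.Seq[OF start[of m2, folded m3_def] aug(1)]]])
  moreover have "3 + (t + (3 + t')) \<le> 45 * ?l + 40"
    using walk(6,7) aug(2) by linarith
  ultimately show ?thesis using aug(3) by blast
qed

text \<open>One phase per free vertex, with start and choices common to all inputs while the
  memories diverge; hence \<open>m\<close> depends on \<open>A\<close> but \<open>F\<close> does
  not. With \<open>k\<close> free vertices a phase costs at most \<open>45 * (n / k) + 40\<close> in
  the weighted mean; the \<open>1\<close> pays for the final \<open>Skip\<close>.\<close>

lemma exists_matching_program:
  fixes p :: "adj_arrays \<Rightarrow> real"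
  assumes "finite X" and "\<And>A. A \<in> X \<Longrightarrow> p A > 0" and "d > 0"
    and "\<And>A. A \<in> X \<Longrightarrow> adj_regular n d (A PSide)" and "n < 2 ^ w" and "F \<subseteq> {..<n}"
    and "\<And>A. A \<in> X \<Longrightarrow> partial_matching n (A PSide) F (m A 0) (m A 1)"
  shows "\<exists>c t m'. (\<forall>A\<in>X. exec w A c (m A) (t A) (m' A) \<and>
             partial_matching n (A PSide) {} (m' A 0) (m' A 1)) \<and>
           (\<Sum>A\<in>X. p A * real (t A)) \<le>
             (\<Sum>A\<in>X. p A) * (1 + (\<Sum>k=1..card F. 45 * (real n / real k) + 40))"
  using assms(6,7)
proof (induction "card F" arbitrary: F m)
  case 0
  then have "F = {}" by (metis card_0_eq finite_lessThan finite_subset)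
  with 0 show ?case
    by (intro exI[of _ Skip] exI[of _ "\<lambda>_. 1"] exI[of _ m])
      (auto intro: exec.Skip simp del: One_nat_def)
next
  case (Suc k)
  have finF: "finite F" using Suc.prems(1) by (rule finite_subset) auto
  have "F \<noteq> {}" using Suc.hyps(2) by auto
  have "\<exists>u\<in>F. \<exists>rs. set rs \<subseteq> {..<d} \<and>
      (\<Sum>A\<in>X. p A * real (walk_len (A PSide) (m A 1) rs (Suc u))) \<le>
        (\<Sum>A\<in>X. p A) * (real n / real (card F)) \<and>
      (\<forall>A\<in>X. walk_len (A PSide) (m A 1) rs (Suc u) < length rs)"
    by (rule exists_start_choices[where f = "\<lambda>A. m A 0"])
      (use assms(1-4) Suc.prems \<open>F \<noteq> {}\<close> in blast)+
  then obtain u rs where u: "u \<in> F" and rs: "set rs \<subseteq> {..<d}"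
    "(\<Sum>A\<in>X. p A * real (walk_len (A PSide) (m A 1) rs (Suc u))) \<le>
       (\<Sum>A\<in>X. p A) * (real n / real (card F))"
    "\<forall>A\<in>X. walk_len (A PSide) (m A 1) rs (Suc u) < length rs"
    by blast
  let ?l = "\<lambda>A. walk_len (A PSide) (m A 1) rs (Suc u)"
  have "\<forall>A\<in>X. \<exists>t m'. exec w A (phase u rs) (m A) t m' \<and> t \<le> 45 * ?l A + 40 \<and>
           partial_matching n (A PSide) (F - {u}) (m' 0) (m' 1)"
    using assms(4,5) rs(1,3) Suc.prems u by (intro ballI exec_phase) auto
  then obtain t1 m1 where t1: "\<forall>A\<in>X. exec w A (phase u rs) (m A) (t1 A) (m1 A) \<and>
      t1 A \<le> 45 * ?l A + 40 \<and> partial_matching n (A PSide) (F - {u}) (m1 A 0) (m1 A 1)"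
    by metis
  have card: "k = card (F - {u})" using Suc.hyps(2) u finF by simp
  have "F - {u} \<subseteq> {..<n}" using Suc.prems(1) by auto
  from Suc.hyps(1)[OF card this, of m1] t1
  obtain c t2 m2 where t2: "\<forall>A\<in>X. exec w A c (m1 A) (t2 A) (m2 A) \<and>
      partial_matching n (A PSide) {} (m2 A 0) (m2 A 1)"
    "(\<Sum>A\<in>X. p A * real (t2 A)) \<le>
      (\<Sum>A\<in>X. p A) * (1 + (\<Sum>k=1..k. 45 * (real n / real k) + 40))"
    unfolding card[symmetric] by auto
  have "(\<Sum>A\<in>X. p A * real (t1 A)) \<le> (\<Sum>A\<in>X. p A * (45 * real (?l A) + 40))"
  proof (intro sum_mono mult_left_mono)
    fix A assume A: "A \<in> X"
    then have "t1 A \<le> 45 * ?l A + 40" using t1 by blast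
    then have "real (t1 A) \<le> real (45 * ?l A + 40)" by (rule of_nat_mono)
    then show "real (t1 A) \<le> 45 * real (?l A) + 40" by simp
    show "0 \<le> p A" using assms(2)[OF A] by simp
  qed
  also have "\<dots> = 45 * (\<Sum>A\<in>X. p A * real (?l A)) + (\<Sum>A\<in>X. p A) * 40"
    by (simp add: distrib_left sum.distrib sum_distrib_left sum_distrib_right mult_ac)
  also have "\<dots> \<le> (\<Sum>A\<in>X. p A) * (45 * (real n / real (Suc k)) + 40)"
    using mult_left_mono[OF rs(2), of 45] unfolding Suc.hyps(2)[symmetric]
    by (simp add: algebra_simps)
  finally have "(\<Sum>A\<in>X. p A * real (t1 A + t2 A)) \<le>
      (\<Sum>A\<in>X. p A) * (1 + (\<Sum>k=1..card F. 45 * (real n / real k) + 40))"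
    using t2(2) unfolding Suc.hyps(2)[symmetric] by (simp add: algebra_simps sum.distrib)
  moreover have "\<forall>A\<in>X. exec w A (Seq (phase u rs) c) (m A) (t1 A + t2 A) (m2 A) \<and>
      partial_matching n (A PSide) {} (m2 A 0) (m2 A 1)"
    using t1 t2(1) by (blast intro: exec.Seq)
  ultimately show ?case
    by (intro exI[of _ "Seq (phase u rs) c"] exI[of _ "\<lambda>A. t1 A + t2 A"] exI[of _ m2]) simp
qed

section \<open>Selecting the program by the degree\<close>

text \<open>Choices must be below the degree, so each degree has its own program; vertex
  \<open>0\<close> reveals which one to run. At \<open>5\<close> units per test the linear search
  stays within \<open>O(n)\<close>.\<close>

fun degree_switch :: "(nat \<Rightarrow> prog) \<Rightarrow> nat \<Rightarrow> prog" where
  "degree_switch c 0 = Skip"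
| "degree_switch c (Suc k) =
     If (Op Equal (Degree PSide (Const 0)) (Const (Suc k))) (c (Suc k)) (degree_switch c k)"

lemma exec_degree_switch:
  assumes "adj_regular n d (A PSide)" and "0 < d" and "d \<le> k" and "k \<le> n" and "n < 2 ^ w"
    and "exec w A (c d) m t m'"
  shows "exec w A (degree_switch c k) m (t + 5 * (Suc k - d)) m'"
  using assms(3,4)
proof (induction k)
  case 0
  then show ?case using assms(2) by simp
next
  case (Suc k)
  have "length (A PSide) = n" "length (A PSide ! 0) = d"
    using assms(1) Suc.prems by (auto simp: adj_regular_def)
  then have test: "expr_val w A m (Op Equal (Degree PSide (Const 0)) (Const (Suc k))) \<noteq> 0
      \<longleftrightarrow> d = Suc k"
    using Suc.prems assms(2,5) by auto
  show ?case
  proof (cases "d = Suc k")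
    case True
    then have "exec w A (degree_switch c (Suc k)) m
        (1 + expr_cost (Op Equal (Degree PSide (Const 0)) (Const (Suc k))) + t) m'"
      unfolding degree_switch.simps using test assms(6) by (intro exec.IfTrue) auto
    moreover have "1 + expr_cost (Op Equal (Degree PSide (Const 0)) (Const (Suc k))) + t =
        t + 5 * (Suc (Suc k) - d)"
      using True by simp
    ultimately show ?thesis by metis
  next
    case False
    then have "exec w A (degree_switch c k) m (t + 5 * (Suc k - d)) m'"
      using Suc by simp
    then have "exec w A (degree_switch c (Suc k)) m
        (1 + expr_cost (Op Equal (Degree PSide (Const 0)) (Const (Suc k))) +
          (t + 5 * (Suc k - d))) m'"
      unfolding degree_switch.simps using False test by (intro exec.IfFalse) auto
    moreover have "1 + expr_cost (Op Equal (Degree PSide (Const 0)) (Const (Suc k))) +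
        (t + 5 * (Suc k - d)) = t + 5 * (Suc (Suc k) - d)"
      using False Suc.prems by simp
    ultimately show ?thesis by metis
  qed
qed

section \<open>Finitely many inputs, and correctness of the output\<close>

definition inputs :: "nat \<Rightarrow> adj_arrays set" where
  "inputs n = {A. \<exists>E. regular_bipartite n E \<and> represents n E A}"

text \<open>The arrays are duplicate-free with entries below \<open>n\<close>, hence of length at
  most \<open>n\<close>, and an input is determined by its values at the two sides.\<close>

lemma finite_inputs: "finite (inputs n)"
proof -
  define W where "W = {xs :: nat list. set xs \<subseteq> {..<n} \<and> length xs \<le> n}"
  define Y where "Y = {a. set a \<subseteq> W \<and> length a = n}"
  have "finite W" unfolding W_def by (rule finite_lists_length_le) simp
  then have "finite Y" unfolding Y_def by (rule finite_lists_length_eq)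
  have "A s \<in> Y" if A: "A \<in> inputs n" for A s
  proof -
    obtain E where E: "E \<subseteq> {..<n} \<times> {..<n}" "represents n E A"
      using A by (auto simp: inputs_def regular_bipartite_def)
    have len: "length (A s) = n" using E(2) by (simp add: represents_def)
    have "A s ! u \<in> W" if "u < n" for u
    proof -
      have "distinct (A s ! u)" "set (A s ! u) = neighbours E s u"
        using E(2) that by (simp_all add: represents_def)
      moreover have "neighbours E s u \<subseteq> {..<n}"
        using E(1) by (auto simp: neighbours_def split: side.splits)
      ultimately show ?thesis
        using card_mono[of "{..<n}" "neighbours E s u"] by (simp add: W_def flip: distinct_card)
    qed
    then show ?thesis using len by (auto simp: Y_def in_set_conv_nth)
  qed
  then have "(\<lambda>A. (A PSide, A QSide)) ` inputs n \<subseteq> Y \<times> Y" by auto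
  then have "finite ((\<lambda>A. (A PSide, A QSide)) ` inputs n)"
    by (rule finite_subset) (simp add: \<open>finite Y\<close>)
  moreover have "inj_on (\<lambda>A. (A PSide, A QSide)) (inputs n)"
  proof (rule inj_onI, rule ext)
    fix A B :: adj_arrays and s
    assume "(A PSide, A QSide) = (B PSide, B QSide)"
    then show "A s = B s" by (cases s) auto
  qed
  ultimately show ?thesis by (rule finite_imageD)
qed

lemma adj_regular_represents:
  assumes "regular_bipartite n E" and "represents n E A" and "n \<ge> 1"
  shows "\<exists>d. 0 < d \<and> d \<le> n \<and> adj_regular n d (A PSide)"
proof -
  obtain d where d: "d \<ge> 1" "\<And>s u. u < n \<Longrightarrow> card (neighbours E s u) = d"
    and E: "E \<subseteq> {..<n} \<times> {..<n}"
    using assms(1) unfolding regular_bipartite_def by blast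
  have A: "length (A PSide) = n"
    "\<And>u. u < n \<Longrightarrow> distinct (A PSide ! u) \<and> set (A PSide ! u) = neighbours E PSide u"
    using assms(2) by (auto simp: represents_def)
  have sub: "neighbours E PSide u \<subseteq> {..<n}" for u
    using E by (auto simp: neighbours_def)
  have "card {u. u < n \<and> q \<in> set (A PSide ! u)} = d" if "q < n" for q
  proof -
    have "{u. u < n \<and> q \<in> set (A PSide ! u)} = neighbours E QSide q"
      using A(2) E by (auto simp: neighbours_def)
    then show ?thesis using d(2) that by simp
  qed
  moreover have "length (A PSide ! u) = d" if "u < n" for u
    using A(2)[OF that] d(2)[OF that, of PSide] distinct_card[of "A PSide ! u"] by simp
  ultimately have "adj_regular n d (A PSide)"
    unfolding adj_regular_def using A sub by auto
  moreover have "d \<le> n"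
    using card_mono[OF _ sub[of 0]] d(2)[of 0 PSide] assms(3) by simp
  ultimately show ?thesis using d(1) by (intro exI[of _ d]) simp
qed

text \<open>\<open>g\<close> provides a left inverse of \<open>f\<close>, so \<open>f\<close> is
  injective on \<open>{..<n}\<close> and, by counting, onto.\<close>

lemma perfect_matching_output:
  assumes "represents n E A" and "partial_matching n (A PSide) {} (m 0) (m 1)"
  shows "perfect_matching n E (output_matching n m)"
proof -
  have m: "m 0 p < n" "(p, m 0 p) \<in> E" "m 1 (m 0 p) = Suc p" if "p < n" for p
    using assms that by (auto simp: partial_matching_def represents_def neighbours_def)
  have inj: "inj_on (m 0) {..<n}"
    by (rule inj_on_inverseI[where g = "\<lambda>q. m 1 q - 1"]) (simp add: m del: One_nat_def)
  have "m 0 ` {..<n} = {..<n}"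
    by (rule card_subset_eq) (use m(1) in \<open>auto simp: card_image[OF inj]\<close>)
  have "\<exists>!p. p < n \<and> q = m 0 p" if "q < n" for q
  proof -
    have "q \<in> m 0 ` {..<n}" using \<open>m 0 ` {..<n} = {..<n}\<close> that by simp
    then obtain p where "p < n" "q = m 0 p" by auto
    then show ?thesis using inj by (intro ex1I[of _ p]) (auto dest: inj_onD)
  qed
  then show ?thesis
    unfolding perfect_matching_def output_matching_def using m(2)
    by (simp add: subset_iff conj_commute)
qed

section \<open>The program for all degrees\<close>

text \<open>The inputs are split by degree; the time bounds of the classes add up because they are
  linear in the weights \<open>p\<close>.\<close>

lemma exists_program:
  fixes p :: "adj_arrays \<Rightarrow> real"
  assumes "n \<ge> 1" and "n < 2 ^ w" and "\<And>A. A \<in> inputs n \<Longrightarrow> p A > 0"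
  shows "\<exists>c. finds_perfect_matching w n c \<and>
           (\<Sum>A\<in>inputs n. p A * real (running_time w c A)) \<le>
           (\<Sum>A\<in>inputs n. p A) * (1 + (\<Sum>k=1..n. 45 * (real n / real k) + 40) + 5 * real n)"
proof -
  define B where "B = 1 + (\<Sum>k=1..n. 45 * (real n / real k) + 40)"
  define X where "X d = {A \<in> inputs n. adj_regular n d (A PSide)}" for d
  have fin: "finite (X d)" for d using finite_inputs[of n] by (simp add: X_def)
  define P where "P d c t m \<longleftrightarrow>
     (\<forall>A\<in>X d. exec w A c initial_memory (t A) (m A) \<and>
        partial_matching n (A PSide) {} (m A 0) (m A 1)) \<and>
     (\<Sum>A\<in>X d. p A * real (t A)) \<le> (\<Sum>A\<in>X d. p A) * B"
    for d c and t :: "adj_arrays \<Rightarrow> nat" and m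
  have "\<exists>c t m. P d c t m" if "d \<in> {1..n}" for d
    unfolding P_def B_def
    by (rule exists_matching_program[where d = d and F = "{..<n}" and m = "\<lambda>_. initial_memory",
          unfolded card_lessThan])
      (use fin that assms in \<open>auto simp: X_def partial_matching_def initial_memory_def\<close>)
  then obtain c t m where "\<And>d. d \<in> {1..n} \<Longrightarrow> P d (c d) (t d) (m d)"
    by metis
  then have c: "\<And>d A. d \<in> {1..n} \<Longrightarrow> A \<in> X d \<Longrightarrow>
        exec w A (c d) initial_memory (t d A) (m d A) \<and>
        partial_matching n (A PSide) {} (m d A 0) (m d A 1)"
      "\<And>d. d \<in> {1..n} \<Longrightarrow> (\<Sum>A\<in>X d. p A * real (t d A)) \<le> (\<Sum>A\<in>X d. p A) * B"
    unfolding P_def by blast+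
  define c' where "c' = degree_switch c n"
  have exec: "exec w A c' initial_memory (t d A + 5 * (Suc n - d)) (m d A)"
    if "d \<in> {1..n}" "A \<in> X d" for d A
    unfolding c'_def using that assms c(1)[OF that]
    by (intro exec_degree_switch) (auto simp: X_def)
  have time: "running_time w c' A \<le> t d A + 5 * n" if "d \<in> {1..n}" "A \<in> X d" for d A
  proof -
    have "running_time w c' A = t d A + 5 * (Suc n - d)"
      unfolding running_time_def
      by (rule the_equality) (use exec[OF that] exec_deterministic in blast)+
    moreover have "Suc n - d \<le> n" using that(1) by (cases d) auto
    ultimately show ?thesis by simp
  qed
  have cover: "\<exists>d\<in>{1..n}. A \<in> X d" if A: "A \<in> inputs n" for A
  proof -
    obtain E where "regular_bipartite n E" "represents n E A"
      using A by (auto simp: inputs_def)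
    from adj_regular_represents[OF this assms(1)] show ?thesis
      using A by (auto simp: X_def Suc_le_eq)
  qed
  have union: "inputs n = (\<Union>d\<in>{1..n}. X d)"
    using cover by (auto simp: X_def)
  have "0 < n" using assms(1) by simp
  \<comment> \<open>The degree can be read off as the array length of vertex \<open>0\<close>, so
    the classes are disjoint.\<close>
  have "i = j" if "A \<in> X i" "A \<in> X j" for i j A
  proof -
    have "length (A PSide ! 0) = i" "length (A PSide ! 0) = j"
      using that \<open>0 < n\<close> unfolding X_def adj_regular_def by blast+
    then show ?thesis by simp
  qed
  then have disj: "\<forall>i\<in>{1..n}. \<forall>j\<in>{1..n}. i \<noteq> j \<longrightarrow> X i \<inter> X j = {}"
    by blast
  have split: "(\<Sum>A\<in>inputs n. h A) = (\<Sum>d=1..n. \<Sum>A\<in>X d. h A)" for h :: "adj_arrays \<Rightarrow> real"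
    unfolding union by (rule sum.UNION_disjoint) (use disj fin in auto)
  have "finds_perfect_matching w n c'"
    unfolding finds_perfect_matching_def
  proof (intro allI impI)
    fix E A assume EA: "regular_bipartite n E \<and> represents n E A"
    then have "A \<in> inputs n" by (auto simp: inputs_def)
    then obtain d where "d \<in> {1..n}" "A \<in> X d" using cover by blast
    with exec c(1) EA show
      "\<exists>t m. exec w A c' initial_memory t m \<and> perfect_matching n E (output_matching n m)"
      by (blast intro: perfect_matching_output)
  qed
  moreover have "(\<Sum>A\<in>inputs n. p A * real (running_time w c' A)) \<le>
      (\<Sum>A\<in>inputs n. p A) * (B + 5 * real n)"
  proof -
    have "(\<Sum>A\<in>X d. p A * real (running_time w c' A)) \<le> (\<Sum>A\<in>X d. p A) * (B + 5 * real n)"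
      if d: "d \<in> {1..n}" for d
    proof -
      have "(\<Sum>A\<in>X d. p A * real (running_time w c' A)) \<le> (\<Sum>A\<in>X d. p A * real (t d A + 5 * n))"
      proof (intro sum_mono mult_left_mono)
        fix A assume A: "A \<in> X d"
        show "real (running_time w c' A) \<le> real (t d A + 5 * n)"
          using time[OF d A] by (rule of_nat_mono)
        have "A \<in> inputs n" using A by (simp add: X_def)
        from assms(3)[OF this] show "0 \<le> p A" by simp
      qed
      also have "\<dots> = (\<Sum>A\<in>X d. p A * real (t d A)) + (\<Sum>A\<in>X d. p A) * (5 * real n)"
        by (simp add: distrib_left sum.distrib sum_distrib_right)
      also have "\<dots> \<le> (\<Sum>A\<in>X d. p A) * (B + 5 * real n)"
        using c(2)[OF d] by (simp add: distrib_left)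
      finally show ?thesis .
    qed
    then show ?thesis
      unfolding split sum_distrib_right[of _ "{1..n}"] by (rule sum_mono)
  qed
  ultimately show ?thesis unfolding B_def by blast
qed

section \<open>Growth of the time bound and the average over a distribution\<close>

text \<open>\<open>ln x \<le> x - 1\<close> at \<open>x = n / (n + 1)\<close> gives
  \<open>1 / (n + 1) \<le> ln (n + 1) - ln n\<close>, which telescopes.\<close>

lemma harm_le_ln: "n \<ge> 1 \<Longrightarrow> (\<Sum>k=1..n. 1 / real k) \<le> 1 + ln (real n)"
proof (induction n rule: nat_induct_at_least)
  case base
  show ?case by simp
next
  case (Suc n)
  have "ln (real n / real (Suc n)) \<le> real n / real (Suc n) - 1"
    using Suc.hyps by (intro ln_le_minus_one) simp
  then have "1 / real (Suc n) \<le> ln (real (Suc n)) - ln (real n)"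
    using Suc.hyps by (simp add: ln_div field_simps)
  then show ?case using Suc.IH by simp
qed

text \<open>\<open>91 = 45 + 40 + 5 + 1\<close>, where \<open>1 \<le> n\<close> absorbs the constant
  term.\<close>

lemma program_time_le:
  assumes "n \<ge> 1"
  shows "1 + (\<Sum>k=1..n. 45 * (real n / real k) + 40) + 5 * real n \<le>
           91 * real n + 45 * (real n * ln (real n))"
proof -
  have "(\<Sum>k=1..n. 45 * (real n / real k) + 40) =
      45 * real n * (\<Sum>k=1..n. 1 / real k) + 40 * real n"
    by (simp add: sum.distrib sum_distrib_left)
  also have "\<dots> \<le> 45 * real n * (1 + ln (real n)) + 40 * real n"
    using harm_le_ln[OF assms] by (intro add_right_mono mult_left_mono) auto
  finally show ?thesis using assms by (simp add: algebra_simps)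
qed

text \<open>\<open>w\<close> and \<open>T\<close> are chosen before \<open>n\<close>,
  \<open>D\<close> and \<open>R\<close>, which makes the constants absolute; \<open>R\<close> covers
  any, possibly random, order within the adjacency arrays.\<close>

theorem corollary5:
  "\<exists>(w :: nat \<Rightarrow> nat) (T :: nat \<Rightarrow> real).
     (\<lambda>n. real (w n)) \<in> O(\<lambda>n. ln (real n)) \<and>
     T \<in> O(\<lambda>n. real n * ln (real n)) \<and>
     (\<forall>n\<ge>1. \<forall>(D :: bigraph pmf) (R :: bigraph \<Rightarrow> adj_arrays pmf).
        (\<forall>E\<in>set_pmf D. regular_bipartite n E \<and> (\<forall>A\<in>set_pmf (R E). represents n E A)) \<longrightarrow>
        (\<exists>c. finds_perfect_matching (w n) n c \<and>
             measure_pmf.expectation (bind_pmf D R) (\<lambda>A. real (running_time (w n) c A)) \<le> T n))"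
proof -
  define w :: "nat \<Rightarrow> nat" where "w n = nat \<lceil>log 2 (real n)\<rceil> + 1" for n
  \<comment> \<open>The factor \<open>2\<close> is the total mass of the weights \<open>p\<close>
    below.\<close>
  define T :: "nat \<Rightarrow> real" where "T n = 2 * (91 * real n + 45 * (real n * ln (real n)))" for n
  have w: "n < 2 ^ w n" if "n \<ge> 1" for n
  proof -
    have "log 2 (real n) < real (w n)" unfolding w_def by linarith
    then have "real n < 2 powr real (w n)" using that by (simp add: log_less_iff)
    then have "real n < real (2 ^ w n)" by (simp add: powr_realpow)
    then show ?thesis by (simp only: of_nat_less_iff)
  qed
  have wO: "(\<lambda>n. real (w n)) \<in> O(\<lambda>n. ln (real n))"
  proof -
    have "(\<lambda>n. real (w n)) \<in> O(\<lambda>n. log 2 (real n) + 2)"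
    proof (rule bigoI[where c = 1], rule eventually_mono[OF eventually_ge_at_top[of 1]])
      fix n :: nat assume "n \<ge> 1"
      then have "0 \<le> log 2 (real n)" by simp
      then have "real (w n) \<le> log 2 (real n) + 2" unfolding w_def by linarith
      then show "norm (real (w n)) \<le> 1 * norm (log 2 (real n) + 2)" by simp
    qed
    also have "(\<lambda>n. log 2 (real n) + 2) \<in> O(\<lambda>n. ln (real n))" by real_asymp
    finally show ?thesis .
  qed
  have TO: "T \<in> O(\<lambda>n. real n * ln (real n))" unfolding T_def by real_asymp
  have main: "\<exists>c. finds_perfect_matching (w n) n c \<and>
      measure_pmf.expectation (bind_pmf D R) (\<lambda>A. real (running_time (w n) c A)) \<le> T n"
    if n: "n \<ge> 1" and DR: "\<forall>E\<in>set_pmf D. regular_bipartite n E \<and>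
      (\<forall>A\<in>set_pmf (R E). represents n E A)" for n and D :: "bigraph pmf" and R
  proof -
    let ?M = "bind_pmf D R" and ?X = "inputs n"
    have sub: "set_pmf ?M \<subseteq> ?X" using DR by (auto simp: inputs_def)
    then have ne: "?X \<noteq> {}" using set_pmf_not_empty[of ?M] by blast
    \<comment> \<open>Uniform extra weight of total mass \<open>1\<close> makes every input
      positive, so that all walks can be forced to end. This only doubles the total mass, and the
      sum weighted by \<open>p\<close> dominates the expectation as times are nonnegative.\<close>
    define p where "p A = pmf ?M A + 1 / real (card ?X)" for A
    have cpos: "card ?X > 0" using ne finite_inputs by (simp add: card_gt_0_iff)
    then have pos: "p A > 0" for A by (simp add: p_def add_nonneg_pos)
    have "\<exists>c. finds_perfect_matching (w n) n c \<and>
        (\<Sum>A\<in>?X. p A * real (running_time (w n) c A)) \<le>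
        (\<Sum>A\<in>?X. p A) * (1 + (\<Sum>k=1..n. 45 * (real n / real k) + 40) + 5 * real n)"
      using n w[OF n] pos by (rule exists_program)
    then obtain c where
      c: "finds_perfect_matching (w n) n c"
         "(\<Sum>A\<in>?X. p A * real (running_time (w n) c A)) \<le>
          (\<Sum>A\<in>?X. p A) * (1 + (\<Sum>k=1..n. 45 * (real n / real k) + 40) + 5 * real n)"
      by blast
    have "measure_pmf.expectation ?M (\<lambda>A. real (running_time (w n) c A)) =
        (\<Sum>A\<in>?X. pmf ?M A * real (running_time (w n) c A))"
      by (subst integral_measure_pmf[OF finite_inputs[of n]]) (use sub in auto)
    also have "\<dots> \<le> (\<Sum>A\<in>?X. p A * real (running_time (w n) c A))"
      by (intro sum_mono mult_right_mono) (auto simp: p_def)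
    also note c(2)
    also have "(\<Sum>A\<in>?X. p A) = 2"
      using cpos sum_pmf_eq_1[OF finite_inputs sub] by (simp add: p_def sum.distrib)
    also have "2 * (1 + (\<Sum>k=1..n. 45 * (real n / real k) + 40) + 5 * real n) \<le> T n"
      unfolding T_def using program_time_le[OF n] by (intro mult_left_mono) auto
    finally show ?thesis using c(1) by blast
  qed
  show ?thesis using wO TO main by blast
qed

end
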